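(* Suppose that (i) $G=(V,E)$, $V=\{1,\dots,n\}$, is a bidirectional connected graph; (ii) the formation defined by the vectors $\mathbf{r}_{ij}\in\mathbb{R}^d$, $(i,j)\in E$, is valid; (iii) $U\ge n$; (iv) starting from positions $\mathbf{p}_1(1),\dots,\mathbf{p}_n(1)\in\mathbb{R}^d$ with $\mathbf{y}_i(1)=\mathbf{p}_i(1)$, every node $i$ implements, for all $t\ge1$, the update $$\mathbf{y}_i(t+1)=\mathbf{p}_i(t)+\frac12\sum_{j\in N(i)}\frac{\mathbf{p}_j(t)-\mathbf{p}_i(t)-\mathbf{r}_{ij}}{\max(d(i),d(j))},$$ $$\mathbf{p}_i(t+1)=\mathbf{y}_i(t+1)+\left(1-\frac{2}{9U+1}\right)\left(\mathbf{y}_i(t+1)-\mathbf{y}_i(t)\right).$$ Let $\overline{\mathbf{p}}_1,\dots,\overline{\mathbf{p}}_n$ be the unique collection of points in formation with $\frac1n\sum_{i=1}^n\overline{\mathbf{p}}_i=\frac1n\sum_{i=1}^n\mathbf{p}_i(1)$. Then for all $t\ge1$, $$\sum_{i=1}^n\|\mathbf{y}_i(t)-\overline{\mathbf{p}}_i\|_2^2\le 2\left(1-\frac{1}{9U}\right)^{t-1}\sum_{i=1}^n\|\mathbf{y}_i(1)-\overline{\mathbf{p}}_i\|_2^2 .$$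
   Context: A bidirectional graph has an edge set $E$ consisting of ordered pairs such that $(i,j)\in E$ implies $(j,i)\in E$. $N(i)$ is the set of neighbors of node $i$ (with $i\notin N(i)$) and $d(i)=|N(i)|$ is its degree. Each edge $(i,j)\in E$ carries a vector $\mathbf{r}_{ij}\in\mathbb{R}^d$. Points $\mathbf{p}_1,\dots,\mathbf{p}_n\in\mathbb{R}^d$ are "in formation" if $\mathbf{p}_j-\mathbf{p}_i=\mathbf{r}_{ij}$ for all $(i,j)\in E$. The formation defined by the $\mathbf{r}_{ij}$ is valid if at least one collection of points is in formation. *)

theory Defs
  imports "HOL-Analysis.Analysis"
begin

definition bidirectional_graph :: "'v set \<Rightarrow> ('v \<times> 'v) set \<Rightarrow> bool" where
  "bidirectional_graph V E \<longleftrightarrow> E \<subseteq> V \<times> V \<and> sym E"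

definition connected_graph :: "'v set \<Rightarrow> ('v \<times> 'v) set \<Rightarrow> bool" where
  "connected_graph V E \<longleftrightarrow> V \<noteq> {} \<and> (\<forall>i\<in>V. \<forall>j\<in>V. (i, j) \<in> E\<^sup>*)"

text \<open>Self-loops are not forbidden in the edge set, but a node is never its own neighbor.\<close>

definition nbrs :: "('v \<times> 'v) set \<Rightarrow> 'v \<Rightarrow> 'v set" where
  "nbrs E i = {j. (i, j) \<in> E \<and> j \<noteq> i}"

definition deg :: "('v \<times> 'v) set \<Rightarrow> 'v \<Rightarrow> nat" where
  "deg E i = card (nbrs E i)"

definition in_formation ::
    "('v \<times> 'v) set \<Rightarrow> ('v \<Rightarrow> 'v \<Rightarrow> real ^ 'd) \<Rightarrow> ('v \<Rightarrow> real ^ 'd) \<Rightarrow> bool" where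
  "in_formation E r q \<longleftrightarrow> (\<forall>(i, j)\<in>E. q j - q i = r i j)"

definition valid_formation ::
    "('v \<times> 'v) set \<Rightarrow> ('v \<Rightarrow> 'v \<Rightarrow> real ^ 'd) \<Rightarrow> bool" where
  "valid_formation E r \<longleftrightarrow> (\<exists>q. in_formation E r q)"

definition centroid :: "nat \<Rightarrow> (nat \<Rightarrow> real ^ 'd) \<Rightarrow> real ^ 'd" where
  "centroid n q = (1 / real n) *\<^sub>R (\<Sum>i=1..n. q i)"

end

theory Submission
  imports Defs "HOL-Library.Function_Algebras"
begin

text \<open>
  Let \<open>q\<close> be the formation whose centroid is that of the initial positions; it exists and is unique
  because a formation on a connected graph is determined up to a translation. The errors
  \<open>z(t) = y(t) - q\<close> and \<open>x(t) = p(t) - q\<close> satisfy \<open>z(t+1) = W x(t)\<close> and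
  \<open>x(t+1) = z(t+1) + \<sigma> (z(t+1) - z(t))\<close>, where \<open>W\<close> averages the error at a node with those at its
  neighbors, using half the Metropolis weights, and \<open>\<sigma> = (9U - 1)/(9U + 1)\<close>. The error keeps mean
  zero. Hence the claim is about Nesterov's accelerated iteration for a self-adjoint, positive
  semidefinite \<open>W\<close>, and it follows from two facts.

  The first is a spectral gap (lemmas \<open>shortest_path\<close>, \<open>dist_le_dirichlet\<close>, \<open>metropolis_gap\<close>). The
  degrees along a shortest path sum to at most \<open>3n\<close>, because a node is a neighbor of at most three
  nodes of such a path. Hence the resistances \<open>max(d(i), d(j))\<close> along the path sum to at most
  \<open>6n\<close>, and Cauchy-Schwarz bounds the squared difference of \<open>f\<close> at any two nodes by \<open>6n\<close> times
  the Dirichlet form of \<open>f\<close>. Summation over one of the two nodes shows that on mean-zero functions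
  the eigenvalues of \<open>W\<close> are at most \<open>1 - 1/(24 n\<^sup>2)\<close>, which is below \<open>1 - 2/(9U)\<^sup>2\<close>.

  The second is a quadratic energy that shrinks at least by the factor \<open>\<sigma> \<le> 1 - 1/(9U)\<close> at every step
  (locale \<open>accelerated_form\<close>). The differences \<open>z(t+1) - z(t)\<close> all lie in the image of \<open>1 - W\<close>, so
  there is an auxiliary sequence with \<open>z(t+1) - z(t) = (1 - W) u(t+1)\<close>, given by \<open>u(1) = 0\<close> and
  \<open>u(t+1) = \<sigma> W u(t) - z(t)\<close>. In terms of \<open>z\<close> and \<open>u\<close> the energy starts at \<open>\<parallel>z(1)\<parallel>\<^sup>2\<close> and, by the
  gap, never falls below \<open>\<parallel>z(t)\<parallel>\<^sup>2 / 2\<close>; this is the source of the factor 2. All estimates are between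
  quadratic forms, so no diagonalization of \<open>W\<close> occurs.
\<close>

section \<open>Accelerated iteration of a self-adjoint contraction\<close>

text \<open>
  \<open>B\<close> is a positive semidefinite form in the role of the inner product. It may be degenerate, so
  that functions on all of a type can be measured on a finite set of nodes only. The gap is
  required on the invariant subspace \<open>M\<close>, which will consist of the functions with mean zero. Its size
  \<open>2/q\<^sup>2\<close> is twice the \<open>1/q\<^sup>2\<close> to which the momentum \<open>\<sigma>\<close> is tuned; this margin keeps the energy
  below comparable to \<open>B z z\<close>, whereas it degenerates at the eigenvalue \<open>1 - 1/q\<^sup>2\<close>.
\<close>
locale accelerated_form =
  fixes B :: "'b::real_vector \<Rightarrow> 'b \<Rightarrow> real"
    and W :: "'b \<Rightarrow> 'b"
    and M :: "'b set"
    and q :: real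
  assumes bil: "bilinear B"
    and sym: "B x y = B y x"
    and nonneg: "0 \<le> B x x"
    and lin: "linear W"
    and selfadjoint: "B (W x) y = B x (W y)"
    and W_nonneg: "0 \<le> B x (W x)"
    and subspace_M: "subspace M"
    and W_in_M: "x \<in> M \<Longrightarrow> W x \<in> M"
    and q_ge_2: "2 \<le> q"
    and gap: "x \<in> M \<Longrightarrow> B x (W x) \<le> (1 - 2 / q\<^sup>2) * B x x"
begin

definition \<sigma> :: real where
  "\<sigma> = (q - 1) / (q + 1)"

text \<open>
  On an eigenvector of \<open>W\<close> for \<open>\<lambda>\<close> the sequence \<open>z\<close> satisfies
  \<open>z\<^sub>t\<^sub>+\<^sub>1 = \<lambda>(1 + \<sigma>) z\<^sub>t - \<lambda>\<sigma> z\<^sub>t\<^sub>-\<^sub>1\<close>, and the binary form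
  \<open>z\<^sub>t\<^sub>+\<^sub>1\<^sup>2 - \<lambda>(1 + \<sigma>) z\<^sub>t\<^sub>+\<^sub>1 z\<^sub>t + \<lambda>\<sigma> z\<^sub>t\<^sup>2\<close> is multiplied by exactly \<open>\<lambda>\<sigma>\<close> in each step.
  With \<open>z\<^sub>t\<^sub>+\<^sub>1 - z\<^sub>t = (1 - \<lambda>) u\<^sub>t\<^sub>+\<^sub>1\<close> this form is divisible by \<open>1 - \<lambda>\<close>; the quotient, with \<open>\<lambda>\<close>
  replaced by \<open>W\<close>, is the energy.
\<close>
definition energy :: "'b \<Rightarrow> 'b \<Rightarrow> real" where
  "energy z u = B z z + (1 - \<sigma>) * B z (W u) + \<sigma> * (B u (W u) - B (W u) (W u))"

lemmas expand =
  bilinear_ladd[OF bil] bilinear_radd[OF bil] bilinear_lsub[OF bil] bilinear_rsub[OF bil]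
  bilinear_lmul[OF bil] bilinear_rmul[OF bil]
  linear_add[OF lin] linear_diff[OF lin] linear_scale[OF lin]

lemma \<sigma>_pos: "0 < \<sigma>"
  using q_ge_2 by (simp add: \<sigma>_def)

lemma one_minus_\<sigma>: "1 - \<sigma> = 2 / (q + 1)"
  using q_ge_2 by (simp add: \<sigma>_def field_simps)

lemma gap_factor_pos: "0 < 1 - 2 / q\<^sup>2"
proof -
  have "4 \<le> q\<^sup>2"
    using power_mono[OF q_ge_2, of 2] by simp
  then show ?thesis
    by (auto simp: divide_less_eq)
qed

text \<open>
  Spectrally this is \<open>\<lambda>\<^sup>2 \<le> l \<lambda>\<close> for \<open>0 \<le> \<lambda> \<le> l\<close>. It follows from positivity of \<open>W\<close> at
  \<open>l u - W u\<close> together with the gap at \<open>W u\<close>.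
\<close>
lemma image_norm_le:
  assumes "u \<in> M"
  shows "B (W u) (W u) \<le> (1 - 2 / q\<^sup>2) * B u (W u)"
proof -
  define l where "l = 1 - 2 / q\<^sup>2"
  have "0 \<le> B (l *\<^sub>R u - W u) (W (l *\<^sub>R u - W u))"
    by (rule W_nonneg)
  also have "\<dots> = l * (l * B u (W u)) - 2 * l * B (W u) (W u) + B (W u) (W (W u))"
    by (simp add: expand selfadjoint algebra_simps)
  also have "B (W u) (W (W u)) \<le> l * B (W u) (W u)"
    using gap[OF W_in_M[OF assms]] by (simp add: l_def)
  finally have "0 \<le> l * (l * B u (W u) - B (W u) (W u))"
    by (simp add: algebra_simps)
  then show ?thesis
    using gap_factor_pos by (simp add: l_def[symmetric] zero_le_mult_iff)
qed

text \<open>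
  The gap makes the last summand of the energy at least \<open>2\<sigma>/(q\<^sup>2 - 2)\<close> times the squared norm of
  \<open>W u\<close>, which is large enough to complete the square with the mixed term at the cost of
  half of \<open>B z z\<close>.
\<close>
lemma norm_le_energy:
  assumes "u \<in> M"
  shows "B z z / 2 \<le> energy z u"
proof -
  let ?b = "B (W u) (W u)" and ?a = "B u (W u)"
  have q2: "q\<^sup>2 - 2 > 0"
    using gap_factor_pos q_ge_2 by (auto simp: field_simps)
  have "2 * ?b \<le> (q\<^sup>2 - 2) * (?a - ?b)"
    using image_norm_le[OF assms] q_ge_2 by (simp add: field_simps)
  then have "2 / (q\<^sup>2 - 2) * ?b \<le> ?a - ?b"
    using q2 by (simp add: field_simps)
  then have "\<sigma> * (2 / (q\<^sup>2 - 2) * ?b) \<le> \<sigma> * (?a - ?b)"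
    using \<sigma>_pos by (intro mult_left_mono) auto
  then have low: "\<sigma> * (2 / (q\<^sup>2 - 2)) * ?b \<le> \<sigma> * (?a - ?b)"
    by (simp only: mult.assoc)
  have "(1 - \<sigma>)\<^sup>2 / 2 \<le> \<sigma> * (2 / (q\<^sup>2 - 2))"
  proof -
    have "(1 - \<sigma>)\<^sup>2 / 2 = 2 / (q + 1)\<^sup>2"
      by (simp add: one_minus_\<sigma> power_divide)
    also have "\<dots> = (q - 1) / (q + 1) * (2 / ((q - 1) * (q + 1)))"
      using q_ge_2 by (simp add: divide_simps power2_eq_square)
    also have "\<dots> = \<sigma> * (2 / ((q - 1) * (q + 1)))"
      by (simp only: \<sigma>_def)
    also have "\<dots> \<le> \<sigma> * (2 / (q\<^sup>2 - 2))"
      using \<sigma>_pos q2 by (intro mult_left_mono divide_left_mono mult_pos_pos)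
        (use q_ge_2 in \<open>auto simp: algebra_simps power2_eq_square\<close>)
    finally show ?thesis .
  qed
  then have "(1 - \<sigma>)\<^sup>2 / 2 * ?b \<le> \<sigma> * (2 / (q\<^sup>2 - 2)) * ?b"
    using nonneg by (intro mult_right_mono)
  moreover have "0 \<le> B (z + (1 - \<sigma>) *\<^sub>R W u) (z + (1 - \<sigma>) *\<^sub>R W u)"
    by (rule nonneg)
  moreover have "\<dots> = B z z + 2 * ((1 - \<sigma>) * B z (W u)) + 2 * ((1 - \<sigma>)\<^sup>2 / 2 * ?b)"
    using sym[of "W u" z] by (simp add: expand field_simps power2_eq_square)
  ultimately show ?thesis
    using low unfolding energy_def by linarith
qed

text \<open>
  The new energy is \<open>\<sigma>\<close> times the old one with an extra factor \<open>W\<close> in each term. Replacing that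
  \<open>W\<close> by the identity adds a form which, after completing the square with respect to \<open>W\<close>, is
  nonnegative as soon as \<open>B z (W z) \<le> (1 - 1/q\<^sup>2) B z z\<close>; the bound \<open>1 - 1/q\<^sup>2\<close> equals
  \<open>4\<sigma>/(1 + \<sigma>)\<^sup>2\<close>, the eigenvalue at which the recurrence has a double characteristic root.
\<close>
lemma energy_step:
  assumes "z \<in> M" and u': "u' = \<sigma> *\<^sub>R W u - z" and z': "z' = z + (u' - W u')"
  shows "energy z' u' \<le> \<sigma> * energy z u"
proof -
  have canon: "B u z = B z u" "B (W u) z = B z (W u)"
    by (simp_all only: sym[of u z] sym[of "W u" z])
  \<comment> \<open>\<open>a\<close> is the shift that completes the square of the form given by \<open>W\<close> in \<open>w\<close>.\<close>
  define w where "w = u - W u"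
  define a where "a = (1 - \<sigma>) / (2 * \<sigma>)"
  have a: "\<sigma> * a * 2 = 1 - \<sigma>" "\<sigma> * a\<^sup>2 = (1 - \<sigma>)\<^sup>2 / (4 * \<sigma>)"
    using \<sigma>_pos by (auto simp: a_def field_simps power2_eq_square)
  \<comment> \<open>The bracket is \<open>energy z u\<close> with one more factor \<open>W\<close> in every term.\<close>
  have eq: "energy z' u' = \<sigma> * (B z (W z) + (1 - \<sigma>) * B z (W (W u))
      + \<sigma> * (B u (W (W u)) - B u (W (W (W u)))) )"
    unfolding z' u' energy_def
    using sym[of u "W z"] sym[of u "W (W z)"] sym[of u "W (W (W z))"] sym[of u "W (W (W (W z)))"]
    by (simp add: expand selfadjoint canon algebra_simps power2_eq_square)
  have dec: "energy z u - (B z (W z) + (1 - \<sigma>) * B z (W (W u))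
      + \<sigma> * (B u (W (W u)) - B u (W (W (W u)))))
    = \<sigma> * B (w + a *\<^sub>R z) (W (w + a *\<^sub>R z)) + (B z z - B z (W z) - \<sigma> * a\<^sup>2 * B z (W z))"
  proof -
    have "\<sigma> * B (w + a *\<^sub>R z) (W (w + a *\<^sub>R z)) =
        \<sigma> * B w (W w) + (\<sigma> * a * 2) * B z (W w) + \<sigma> * a\<^sup>2 * B z (W z)"
      using sym[of w "W z"] by (simp add: expand selfadjoint algebra_simps power2_eq_square)
    also have "\<dots> = \<sigma> * (B u (W u) - 2 * B u (W (W u)) + B u (W (W (W u))))
        + (1 - \<sigma>) * (B z (W u) - B z (W (W u))) + \<sigma> * a\<^sup>2 * B z (W z)"
      unfolding a w_def by (simp add: expand selfadjoint algebra_simps)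
    finally show ?thesis
      by (simp add: energy_def selfadjoint algebra_simps)
  qed
  have "(1 + \<sigma> * a\<^sup>2) * B z (W z) \<le> (1 + \<sigma> * a\<^sup>2) * ((1 - 2 / q\<^sup>2) * B z z)"
    using gap[OF assms(1)] \<sigma>_pos by (intro mult_left_mono) auto
  also have "\<dots> \<le> 1 * B z z"
  proof -
    have e: "\<sigma> * a\<^sup>2 = 1 / (q\<^sup>2 - 1)"
    proof -
      have "\<sigma> * a\<^sup>2 = 4 / (q + 1)\<^sup>2 / (4 * \<sigma>)"
        by (simp only: a one_minus_\<sigma> power_divide) simp
      also have "\<dots> = 1 / ((q + 1) * ((q + 1) * \<sigma>))"
        by (simp add: power2_eq_square)
      also have "(q + 1) * \<sigma> = q - 1"
        using q_ge_2 by (simp add: \<sigma>_def)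
      finally show ?thesis
        by (simp add: power2_eq_square algebra_simps)
    qed
    have "q\<^sup>2 > 1"
      using gap_factor_pos q_ge_2 by (auto simp: field_simps)
    then have "(1 + \<sigma> * a\<^sup>2) * (1 - 2 / q\<^sup>2) \<le> 1"
      unfolding e using q_ge_2 by (simp add: field_simps)
    then show ?thesis
      using nonneg[of z] by (simp only: mult.assoc[symmetric] mult_right_mono)
  qed
  finally have "0 \<le> B z z - B z (W z) - \<sigma> * a\<^sup>2 * B z (W z)"
    by (simp add: algebra_simps)
  moreover have "0 \<le> \<sigma> * B (w + a *\<^sub>R z) (W (w + a *\<^sub>R z))"
    using W_nonneg \<sigma>_pos by simp
  ultimately have "B z (W z) + (1 - \<sigma>) * B z (W (W u))
      + \<sigma> * (B u (W (W u)) - B u (W (W (W u)))) \<le> energy z u"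
    using dec by linarith
  then show ?thesis
    unfolding eq using \<sigma>_pos by (intro mult_left_mono) auto
qed

text \<open>
  The energy controls \<open>z\<close> once the auxiliary sequence \<open>u\<close> is available. It is defined by its
  recurrence and starts at 0, since \<open>x 0 = z 0\<close> means that the iteration starts without momentum;
  therefore the initial energy is \<open>B (z 0) (z 0)\<close>.
\<close>
theorem convergence:
  assumes start: "z 0 \<in> M" "x 0 = z 0"
    and z_Suc: "\<And>t. z (Suc t) = W (x t)"
    and x_Suc: "\<And>t. x (Suc t) = z (Suc t) + \<sigma> *\<^sub>R (z (Suc t) - z t)"
  shows "B (z t) (z t) \<le> 2 * \<sigma> ^ t * B (z 0) (z 0)"
proof -
  define u where "u = rec_nat 0 (\<lambda>t v. \<sigma> *\<^sub>R W v - z t)"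
  have u: "u 0 = 0" "\<And>t. u (Suc t) = \<sigma> *\<^sub>R W (u t) - z t"
    by (simp_all add: u_def)
  have z_u: "z (Suc t) = z t + (u (Suc t) - W (u (Suc t)))"
    if "x t = z t + \<sigma> *\<^sub>R (u t - W (u t))" for t
    by (simp add: z_Suc that u expand algebra_simps)
  have x_u: "x t = z t + \<sigma> *\<^sub>R (u t - W (u t))" for t
  proof (induction t)
    case 0
    then show ?case
      by (simp add: start u linear_0[OF lin])
  next
    case (Suc t)
    show ?case
      unfolding x_Suc by (simp add: z_u[OF Suc.IH])
  qed
  note z_u = z_u[OF x_u]
  have in_M: "z t \<in> M \<and> u t \<in> M" for t
  proof (induction t)
    case 0
    then show ?case
      by (simp add: start u subspace_0[OF subspace_M])
  next
    case (Suc t)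
    have "u (Suc t) \<in> M"
      unfolding u using Suc.IH
      by (intro subspace_diff[OF subspace_M] subspace_scale[OF subspace_M] W_in_M) auto
    moreover from this have "z (Suc t) \<in> M"
      unfolding z_u using Suc.IH
      by (intro subspace_add[OF subspace_M] subspace_diff[OF subspace_M] W_in_M) auto
    ultimately show ?case
      by simp
  qed
  have "energy (z t) (u t) \<le> \<sigma> ^ t * B (z 0) (z 0)"
  proof (induction t)
    case 0
    show ?case
      by (simp add: energy_def u linear_0[OF lin] bilinear_lzero[OF bil] bilinear_rzero[OF bil])
  next
    case (Suc t)
    have "energy (z (Suc t)) (u (Suc t)) \<le> \<sigma> * energy (z t) (u t)"
      using in_M u(2) z_u by (intro energy_step) auto
    also have "\<dots> \<le> \<sigma> * (\<sigma> ^ t * B (z 0) (z 0))"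
      using Suc.IH \<sigma>_pos by (intro mult_left_mono) auto
    finally show ?case
      by simp
  qed
  then show ?thesis
    using norm_le_energy[of "u t" "z t"] in_M[of t] by simp
qed

end

section \<open>Averaging with symmetric weights\<close>

text \<open>
  The number of nodes is not fixed by a type, so the state space is the vector space of all functions
  on the nodes' type, with pointwise operations.
\<close>
instantiation "fun" :: (type, real_vector) real_vector
begin

definition scaleR_fun :: "real \<Rightarrow> ('a \<Rightarrow> 'b) \<Rightarrow> 'a \<Rightarrow> 'b" where
  "c *\<^sub>R f = (\<lambda>x. c *\<^sub>R f x)"

instance
  by standard (simp_all add: scaleR_fun_def fun_eq_iff algebra_simps)

end

lemma scaleR_fun_apply [simp]: "(c *\<^sub>R f) x = c *\<^sub>R f x"
  by (simp add: scaleR_fun_def)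

definition node_inner :: "'v set \<Rightarrow> ('v \<Rightarrow> 'a::real_inner) \<Rightarrow> ('v \<Rightarrow> 'a) \<Rightarrow> real" where
  "node_inner V f g = (\<Sum>i\<in>V. f i \<bullet> g i)"

lemma bilinear_node_inner: "bilinear (node_inner V)"
  by (auto simp: bilinear_def node_inner_def inner_add_left inner_add_right sum.distrib
        sum_distrib_left intro!: linearI)

definition averaging :: "'v set \<Rightarrow> ('v \<Rightarrow> 'v \<Rightarrow> real) \<Rightarrow> ('v \<Rightarrow> 'a::real_vector) \<Rightarrow> 'v \<Rightarrow> 'a" where
  "averaging V c f = (\<lambda>i. f i + (1 / 2) *\<^sub>R (\<Sum>j\<in>V. c i j *\<^sub>R (f j - f i)))"

lemma linear_averaging: "linear (averaging V c)"
  by (auto simp: averaging_def fun_eq_iff algebra_simps scaleR_sum_right sum.distrib sum_subtractf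
        intro!: linearI)

definition dirichlet ::
    "'v set \<Rightarrow> ('v \<Rightarrow> 'v \<Rightarrow> real) \<Rightarrow> ('v \<Rightarrow> 'a::real_inner) \<Rightarrow> ('v \<Rightarrow> 'a) \<Rightarrow> real" where
  "dirichlet V c f g = (\<Sum>i\<in>V. \<Sum>j\<in>V. c i j * ((f i - f j) \<bullet> (g i - g j)))"

text \<open>
  Summation by parts: exchanging the names of \<open>i\<close> and \<open>j\<close> in the sum over edges symmetrizes it.
  The factor 4 collects the \<open>1/2\<close> of this symmetrization and the \<open>1/2\<close> in the averaging.
\<close>
lemma averaging_inner:
  assumes "\<And>i j. c i j = c j i"
  shows "node_inner V (averaging V c f) g = node_inner V f g - dirichlet V c f g / 4"
proof -
  let ?s = "\<Sum>i\<in>V. \<Sum>j\<in>V. c i j * ((f j - f i) \<bullet> g i)"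
  let ?t = "\<Sum>i\<in>V. \<Sum>j\<in>V. c i j * ((f i - f j) \<bullet> g j)"
  have "?s = (\<Sum>i\<in>V. \<Sum>j\<in>V. c j i * ((f i - f j) \<bullet> g j))"
    by (rule sum.swap)
  also have "\<dots> = ?t"
    by (simp only: assms[of _ _])
  finally have "?s + ?s = ?s + ?t"
    by simp
  also have "\<dots> = - dirichlet V c f g"
    unfolding dirichlet_def sum_negf[symmetric] sum.distrib[symmetric]
    by (intro sum.cong refl) (simp add: inner_simps algebra_simps)
  finally have "?s + ?s = - dirichlet V c f g" .
  then have "?s / 2 = - dirichlet V c f g / 4"
    by simp
  moreover have "node_inner V (averaging V c f) g = node_inner V f g + ?s / 2"
    by (simp add: node_inner_def averaging_def inner_add_left inner_sum_left sum.distrib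
        sum_divide_distrib)
  ultimately show ?thesis
    by simp
qed

lemma sum_averaging:
  fixes f :: "'v \<Rightarrow> 'a::real_vector"
  assumes "\<And>i j. c i j = c j i"
  shows "sum (averaging V c f) V = sum f V"
proof -
  let ?s = "\<Sum>i\<in>V. \<Sum>j\<in>V. c i j *\<^sub>R (f j - f i)"
  have "?s = (\<Sum>i\<in>V. \<Sum>j\<in>V. c j i *\<^sub>R (f i - f j))"
    by (rule sum.swap)
  also have "\<dots> = (\<Sum>i\<in>V. \<Sum>j\<in>V. - (c i j *\<^sub>R (f j - f i)))"
    by (intro sum.cong refl) (simp add: assms[of _ _] algebra_simps)
  also have "\<dots> = - ?s"
    by (simp add: sum_negf)
  finally have "2 *\<^sub>R ?s = 0"
    unfolding scaleR_2 eq_neg_iff_add_eq_0 .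
  then have "?s = 0"
    by simp
  then show ?thesis
    by (simp add: averaging_def sum.distrib scaleR_sum_right[symmetric])
qed

text \<open>
  Together with \<open>averaging_inner\<close> this makes the averaging operator positive semidefinite. It is
  where the laziness of the averaging, the factor \<open>1/2\<close>, enters.
\<close>
lemma dirichlet_le:
  assumes "finite V" "\<And>i j. c i j = c j i" "\<And>i j. 0 \<le> c i j"
    and row: "\<And>i. i \<in> V \<Longrightarrow> (\<Sum>j\<in>V. c i j) \<le> 1"
  shows "dirichlet V c f f \<le> 4 * node_inner V f f"
proof -
  have "dirichlet V c f f \<le> (\<Sum>i\<in>V. \<Sum>j\<in>V. c i j * (2 * (f i \<bullet> f i) + 2 * (f j \<bullet> f j)))"
    unfolding dirichlet_def
  proof (intro sum_mono mult_left_mono assms(3))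
    fix i j
    have "0 \<le> (f i + f j) \<bullet> (f i + f j)"
      by simp
    then show "(f i - f j) \<bullet> (f i - f j) \<le> 2 * (f i \<bullet> f i) + 2 * (f j \<bullet> f j)"
      by (simp add: inner_simps inner_commute)
  qed
  also have "\<dots> = 2 * (\<Sum>i\<in>V. \<Sum>j\<in>V. c i j * (f i \<bullet> f i)) + 2 * (\<Sum>i\<in>V. \<Sum>j\<in>V. c i j * (f j \<bullet> f j))"
    by (simp add: sum.distrib sum_distrib_left algebra_simps)
  also have "(\<Sum>i\<in>V. \<Sum>j\<in>V. c i j * (f j \<bullet> f j)) = (\<Sum>i\<in>V. \<Sum>j\<in>V. c i j * (f i \<bullet> f i))"
    by (subst sum.swap) (simp only: assms(2)[of _ _])
  also have "(\<Sum>i\<in>V. \<Sum>j\<in>V. c i j * (f i \<bullet> f i)) = (\<Sum>i\<in>V. (\<Sum>j\<in>V. c i j) * (f i \<bullet> f i))"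
    by (simp add: sum_distrib_right)
  also have "\<dots> \<le> (\<Sum>i\<in>V. 1 * (f i \<bullet> f i))"
    by (intro sum_mono mult_right_mono row) auto
  finally show ?thesis
    by (simp add: node_inner_def)
qed

section \<open>Spectral gap of the Metropolis weights\<close>

definition metropolis :: "('v \<times> 'v) set \<Rightarrow> 'v \<Rightarrow> 'v \<Rightarrow> real" where
  "metropolis E i j = (if j \<in> nbrs E i then 1 / real (max (deg E i) (deg E j)) else 0)"

lemma metropolis_sym: "sym E \<Longrightarrow> metropolis E i j = metropolis E j i"
  by (auto simp: metropolis_def nbrs_def max.commute dest: symD)

lemma metropolis_row_sum:
  assumes "finite V" "E \<subseteq> V \<times> V"
  shows "(\<Sum>j\<in>V. metropolis E i j) \<le> 1"
proof -
  have fin: "finite (nbrs E i)" and sub: "nbrs E i \<subseteq> V"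
    using assms by (auto simp: nbrs_def intro: finite_subset)
  have "(\<Sum>j\<in>V. metropolis E i j) = (\<Sum>j\<in>nbrs E i. 1 / real (max (deg E i) (deg E j)))"
    using assms(1) sub
    by (auto simp: metropolis_def sum.If_cases Int_absorb1 intro: sum.mono_neutral_cong_right)
  also have "\<dots> \<le> (\<Sum>j\<in>nbrs E i. 1 / real (deg E i))"
  proof (intro sum_mono)
    fix j assume "j \<in> nbrs E i"
    then have "deg E i > 0"
      using fin by (auto simp: deg_def card_gt_0_iff)
    then show "1 / real (max (deg E i) (deg E j)) \<le> 1 / real (deg E i)"
      by (intro divide_left_mono) auto
  qed
  also have "\<dots> \<le> 1"
    by (simp add: deg_def)
  finally show ?thesis .
qed

text \<open>
  Two neighbors of the same node are joined by a walk of length 2, so on a shortest path their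
  positions differ by at most 2. Hence each node is adjacent to at most three nodes of the path,
  and counting adjacent pairs gives the bound on the sum of the degrees. It is stronger than the
  quadratic bound \<open>n\<^sup>2\<close> that holds for an arbitrary path.
\<close>
lemma shortest_path:
  assumes "finite V" "E \<subseteq> V \<times> V" "sym E" and ab: "(a, b) \<in> E\<^sup>*" and "a \<in> V"
  obtains \<gamma> :: "nat \<Rightarrow> 'v" and L where
    "\<gamma> 0 = a" "\<gamma> L = b" "\<gamma> ` {..L} \<subseteq> V"
    "\<And>k. k < L \<Longrightarrow> \<gamma> (Suc k) \<in> nbrs E (\<gamma> k)"
    "inj_on \<gamma> {..L}"
    "(\<Sum>k\<le>L. deg E (\<gamma> k)) \<le> 3 * card V"
proof -
  define L where "L = (LEAST m. (a, b) \<in> E ^^ m)"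
  have L: "(a, b) \<in> E ^^ L"
    unfolding L_def using rtrancl_imp_relpow[OF ab] by (rule LeastI_ex)
  have minimal: "L \<le> m" if "(a, b) \<in> E ^^ m" for m
    unfolding L_def using that by (rule Least_le)
  obtain \<gamma> where \<gamma>: "\<gamma> 0 = a" "\<gamma> L = b" "\<And>k. k < L \<Longrightarrow> (\<gamma> k, \<gamma> (Suc k)) \<in> E"
    using L unfolding relpow_fun_conv by blast
  have segment: "(\<gamma> i, \<gamma> j) \<in> E ^^ (j - i)" if "i \<le> j" "j \<le> L" for i j
    unfolding relpow_fun_conv
    by (rule exI[of _ "\<lambda>k. \<gamma> (i + k)"]) (use that \<gamma>(3) in auto)
  have no_shortcut: "j - i \<le> m" if "i \<le> j" "j \<le> L" "(\<gamma> i, \<gamma> j) \<in> E ^^ m" for i j m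
  proof -
    have "(a, b) \<in> E ^^ (i + (m + (L - j)))"
      using segment[of 0 i] segment[of j L] that \<gamma>(1,2) unfolding relpow_add by auto
    from minimal[OF this] show ?thesis
      using that by simp
  qed
  have inj: "inj_on \<gamma> {..L}"
  proof (rule linorder_inj_onI')
    fix i j assume "i \<in> {..L}" "j \<in> {..L}" "i < j"
    then show "\<gamma> i \<noteq> \<gamma> j"
      using no_shortcut[of i j 0] by auto
  qed
  have in_V: "\<gamma> k \<in> V" if "k \<le> L" for k
    using \<gamma>(1) \<gamma>(3)[of "k - 1"] that assms(2,5) by (cases k) auto
  have few: "card {k \<in> {..L}. v \<in> nbrs E (\<gamma> k)} \<le> 3" for v
  proof (cases "{k \<in> {..L}. v \<in> nbrs E (\<gamma> k)} = {}")
    case False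
    let ?K = "{k \<in> {..L}. v \<in> nbrs E (\<gamma> k)}"
    define m where "m = Min ?K"
    have m: "m \<in> ?K"
      unfolding m_def using False by (intro Min_in) auto
    have "?K \<subseteq> {m..m + 2}"
    proof
      fix k assume k: "k \<in> ?K"
      then have "m \<le> k"
        unfolding m_def by (intro Min_le) auto
      have "(\<gamma> m, v) \<in> E" "(v, \<gamma> k) \<in> E"
        using m k symD[OF assms(3)] by (auto simp: nbrs_def)
      then have "(\<gamma> m, \<gamma> k) \<in> E ^^ 2"
        by (auto simp: numeral_2_eq_2)
      with no_shortcut[OF \<open>m \<le> k\<close>, of 2] k \<open>m \<le> k\<close> show "k \<in> {m..m + 2}"
        by auto
    qed
    then have "card ?K \<le> card {m..m + 2}"
      by (intro card_mono) auto
    then show ?thesis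
      by simp
  qed (simp only: card.empty)
  have "(\<Sum>k\<le>L. deg E (\<gamma> k)) = (\<Sum>k\<le>L. \<Sum>v\<in>V. if v \<in> nbrs E (\<gamma> k) then 1 else 0)"
  proof (intro sum.cong refl)
    fix k
    have "nbrs E (\<gamma> k) = V \<inter> nbrs E (\<gamma> k)"
      using assms(2) by (auto simp: nbrs_def)
    then show "deg E (\<gamma> k) = (\<Sum>v\<in>V. if v \<in> nbrs E (\<gamma> k) then 1 else 0)"
      using assms(1) by (simp add: deg_def sum.If_cases)
  qed
  also have "\<dots> = (\<Sum>v\<in>V. \<Sum>k\<le>L. if v \<in> nbrs E (\<gamma> k) then 1 else 0)"
    by (rule sum.swap)
  also have "\<dots> = (\<Sum>v\<in>V. card {k \<in> {..L}. v \<in> nbrs E (\<gamma> k)})"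
    by (intro sum.cong refl) (auto simp: sum.If_cases intro: arg_cong[of _ _ card])
  also have "\<dots> \<le> (\<Sum>v\<in>V. 3)"
    by (intro sum_mono few)
  finally have deg_sum: "(\<Sum>k\<le>L. deg E (\<gamma> k)) \<le> 3 * card V"
    by simp
  have "\<gamma> (Suc k) \<in> nbrs E (\<gamma> k)" if "k < L" for k
    using \<gamma>(3)[OF that] inj_onD[OF inj, of "Suc k" k] that by (auto simp: nbrs_def)
  then show thesis
    using that[OF \<gamma>(1,2) _ _ inj deg_sum] in_V by auto
qed

text \<open>
  The effective resistance between two nodes is at most the resistance of a shortest path, where
  an edge \<open>(i, j)\<close> has resistance \<open>max (deg i) (deg j) \<le> deg i + deg j\<close>.
\<close>
lemma dist_le_dirichlet:
  fixes f :: "'v \<Rightarrow> 'a::real_inner"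
  assumes "finite V" "E \<subseteq> V \<times> V" "sym E" "(a, b) \<in> E\<^sup>*" "a \<in> V"
  shows "(norm (f b - f a))\<^sup>2 \<le> 6 * real (card V) * dirichlet V (metropolis E) f f"
proof -
  obtain \<gamma> L where \<gamma>: "\<gamma> 0 = a" "\<gamma> L = b" "\<gamma> ` {..L} \<subseteq> V"
    and nb: "\<And>k. k < L \<Longrightarrow> \<gamma> (Suc k) \<in> nbrs E (\<gamma> k)"
    and inj: "inj_on \<gamma> {..L}" and deg_sum: "(\<Sum>k\<le>L. deg E (\<gamma> k)) \<le> 3 * card V"
    using shortest_path[OF assms] by metis
  let ?m = "\<lambda>k. real (max (deg E (\<gamma> k)) (deg E (\<gamma> (Suc k))))"
  let ?d = "\<lambda>k. norm (f (\<gamma> (Suc k)) - f (\<gamma> k))"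
  have fin: "finite (nbrs E v)" for v
    using assms(1,2) by (auto simp: nbrs_def intro: finite_subset[of _ V])
  have m_pos: "0 < ?m k" if "k < L" for k
    using nb[OF that] fin[of "\<gamma> k"] by (auto simp: deg_def card_gt_0_iff less_max_iff_disj)
  have "f b - f a = (\<Sum>k<L. f (\<gamma> (Suc k)) - f (\<gamma> k))"
    using sum_lessThan_telescope[of "\<lambda>k. f (\<gamma> k)" L] by (simp add: \<gamma>)
  then have "norm (f b - f a) \<le> (\<Sum>k<L. ?d k)"
    by (simp add: norm_sum)
  then have "(norm (f b - f a))\<^sup>2 \<le> (\<Sum>k<L. ?d k)\<^sup>2"
    by (intro power_mono) auto
  also have "(\<Sum>k<L. ?d k) = (\<Sum>k<L. sqrt (?m k) * (?d k / sqrt (?m k)))"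
  proof (intro sum.cong refl)
    fix k assume "k \<in> {..<L}"
    then have "sqrt (?m k) \<noteq> 0"
      using m_pos[of k] unfolding real_sqrt_eq_zero_cancel_iff lessThan_iff by linarith
    then show "?d k = sqrt (?m k) * (?d k / sqrt (?m k))"
      by (simp only: times_divide_eq_right nonzero_mult_div_cancel_left
        not_False_eq_True)
  qed
  also have "(\<dots>)\<^sup>2 \<le> (\<Sum>k<L. (sqrt (?m k))\<^sup>2) * (\<Sum>k<L. (?d k / sqrt (?m k))\<^sup>2)"
    by (rule Cauchy_Schwarz_ineq_sum)
  also have "\<dots> = (\<Sum>k<L. ?m k) * (\<Sum>k<L. (?d k)\<^sup>2 / ?m k)"
    by (simp add: power_divide)
  also have "\<dots> \<le> (6 * real (card V)) * dirichlet V (metropolis E) f f"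
  proof (intro mult_mono)
    have "(\<Sum>k<L. ?m k) \<le> (\<Sum>k<L. real (deg E (\<gamma> k)) + real (deg E (\<gamma> (Suc k))))"
      by (intro sum_mono) auto
    also have "\<dots> = (\<Sum>k<L. real (deg E (\<gamma> k))) + (\<Sum>k\<in>Suc ` {..<L}. real (deg E (\<gamma> k)))"
      by (simp add: sum.distrib sum.reindex)
    also have "\<dots> \<le> (\<Sum>k\<le>L. real (deg E (\<gamma> k))) + (\<Sum>k\<le>L. real (deg E (\<gamma> k)))"
      by (intro add_mono sum_mono2) auto
    also have "\<dots> \<le> 6 * real (card V)"
      using of_nat_mono[OF deg_sum, where 'a = real] by simp
    finally show "(\<Sum>k<L. ?m k) \<le> 6 * real (card V)" .
    \<comment> \<open>A shortest path visits no node twice, so its edges are distinct terms of the Dirichlet form.\<close>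
    let ?F = "\<lambda>(i, j). metropolis E i j * ((f i - f j) \<bullet> (f i - f j))"
    let ?e = "\<lambda>k. (\<gamma> k, \<gamma> (Suc k))"
    have "(\<Sum>k<L. (?d k)\<^sup>2 / ?m k) = (\<Sum>k<L. ?F (?e k))"
      using nb by (intro sum.cong refl)
        (simp add: metropolis_def norm_minus_commute flip: power2_norm_eq_inner)
    also have "\<dots> = (\<Sum>e\<in>?e ` {..<L}. ?F e)"
      by (rule sum.reindex_cong[symmetric, where l = ?e])
        (use inj in \<open>auto simp: inj_on_def\<close>)
    also have "\<dots> \<le> (\<Sum>e\<in>V \<times> V. ?F e)"
      using \<gamma>(3) assms(1) by (intro sum_mono2) (auto simp: metropolis_def)
    also have "\<dots> = dirichlet V (metropolis E) f f"
      by (simp add: dirichlet_def sum.cartesian_product)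
    finally show "(\<Sum>k<L. (?d k)\<^sup>2 / ?m k) \<le> dirichlet V (metropolis E) f f" .
  qed (auto intro!: sum_nonneg)
  finally show ?thesis .
qed

text \<open>
  A function of mean zero deviates in square sum from any constant at least as much as from 0;
  the constant taken is its value at one node.
\<close>
lemma metropolis_gap:
  fixes f :: "'v \<Rightarrow> 'a::real_inner"
  assumes "finite V" "E \<subseteq> V \<times> V" "sym E" "connected_graph V E" and mean: "sum f V = 0"
  shows "node_inner V f f \<le> 6 * (real (card V))\<^sup>2 * dirichlet V (metropolis E) f f"
proof -
  obtain a where a: "a \<in> V"
    using assms(4) by (auto simp: connected_graph_def)
  have "node_inner V f f \<le> node_inner V f f + real (card V) * (f a \<bullet> f a)"
    by simp
  also have "\<dots> = node_inner V f f + real (card V) * (f a \<bullet> f a) - 2 * (sum f V \<bullet> f a)"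
    by (simp add: mean)
  also have "\<dots> = (\<Sum>b\<in>V. (norm (f b - f a))\<^sup>2)"
    by (simp add: node_inner_def power2_norm_eq_inner inner_diff_left inner_diff_right
        inner_commute sum.distrib sum_subtractf inner_sum_left inner_sum_right sum_distrib_left algebra_simps)
  also have "\<dots> \<le> (\<Sum>b\<in>V. 6 * real (card V) * dirichlet V (metropolis E) f f)"
    using assms a by (intro sum_mono dist_le_dirichlet) (auto simp: connected_graph_def)
  finally show ?thesis
    by (simp add: power2_eq_square algebra_simps)
qed

lemma node_inner_commute: "node_inner V f g = node_inner V g f"
  by (simp add: node_inner_def inner_commute)

lemma averaging_metropolis:
  assumes "finite V" "E \<subseteq> V \<times> V"
  shows "averaging V (metropolis E) f i =
    f i + (1 / 2) *\<^sub>R (\<Sum>j\<in>nbrs E i. (1 / real (max (deg E i) (deg E j))) *\<^sub>R (f j - f i))"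
proof -
  have "nbrs E i \<subseteq> V"
    using assms(2) by (auto simp: nbrs_def)
  then have "(\<Sum>j\<in>V. metropolis E i j *\<^sub>R (f j - f i)) =
      (\<Sum>j\<in>nbrs E i. (1 / real (max (deg E i) (deg E j))) *\<^sub>R (f j - f i))"
    using assms(1) by (intro sum.mono_neutral_cong_right) (auto simp: metropolis_def)
  then show ?thesis
    by (simp only: averaging_def)
qed

text \<open>
  The gap \<open>1/(24 n\<^sup>2)\<close> exceeds the required \<open>2/(9U)\<^sup>2\<close> because \<open>n \<le> U\<close> and \<open>48 \<le> 81\<close>.
\<close>
lemma metropolis_accelerated_form:
  assumes V: "finite V" and E: "E \<subseteq> V \<times> V" "sym E" and conn: "connected_graph V E"
    and U: "U \<ge> real (card V)"
  shows "accelerated_form (node_inner V :: ('v \<Rightarrow> 'a::real_inner) \<Rightarrow> _)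
    (averaging V (metropolis E)) {f. sum f V = 0} (9 * U)"
proof (rule accelerated_form.intro)
  note sym = metropolis_sym[OF E(2)]
  have left: "node_inner V (averaging V (metropolis E) f) g =
      node_inner V f g - dirichlet V (metropolis E) f g / 4" for f g :: "'v \<Rightarrow> 'a"
    by (rule averaging_inner[OF sym])
  have right: "node_inner V f (averaging V (metropolis E) g) =
      node_inner V f g - dirichlet V (metropolis E) f g / 4" for f g :: "'v \<Rightarrow> 'a"
  proof -
    have "dirichlet V (metropolis E) g f = dirichlet V (metropolis E) f g"
      by (simp add: dirichlet_def inner_commute)
    then show ?thesis
      using left[of g f] by (simp only: node_inner_commute[of V f])
  qed
  have "V \<noteq> {}"
    using conn by (auto simp: connected_graph_def)
  then have "1 \<le> real (card V)"
    using V by (simp add: Suc_le_eq card_gt_0_iff)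
  with U have U1: "1 \<le> U"
    by simp
  fix x y :: "'v \<Rightarrow> 'a"
  show "bilinear (node_inner V :: ('v \<Rightarrow> 'a) \<Rightarrow> _)"
    by (rule bilinear_node_inner)
  show "node_inner V x y = node_inner V y x"
    by (rule node_inner_commute)
  show "0 \<le> node_inner V x x"
    by (simp add: node_inner_def sum_nonneg)
  show "linear (averaging V (metropolis E) :: ('v \<Rightarrow> 'a) \<Rightarrow> _)"
    by (rule linear_averaging)
  show "node_inner V (averaging V (metropolis E) x) y = node_inner V x (averaging V (metropolis E) y)"
    by (simp only: left right)
  show "0 \<le> node_inner V x (averaging V (metropolis E) x)"
  proof -
    have "dirichlet V (metropolis E) x x \<le> 4 * node_inner V x x"
      by (intro dirichlet_le V sym metropolis_row_sum E) (simp add: metropolis_def)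
    then show ?thesis
      by (simp add: right)
  qed
  show "subspace {f :: 'v \<Rightarrow> 'a. sum f V = 0}"
    by (simp add: subspace_def sum.distrib scaleR_sum_right[symmetric])
  show "averaging V (metropolis E) x \<in> {f. sum f V = 0}" if "x \<in> {f. sum f V = 0}"
    using that by (simp add: sum_averaging sym)
  show "2 \<le> 9 * U"
    using U1 by simp
  show "node_inner V x (averaging V (metropolis E) x) \<le> (1 - 2 / (9 * U)\<^sup>2) * node_inner V x x"
    if "x \<in> {f. sum f V = 0}"
  proof -
    let ?D = "dirichlet V (metropolis E) x x"
    have D: "0 \<le> ?D"
      by (auto simp: dirichlet_def metropolis_def intro!: sum_nonneg)
    have "node_inner V x x \<le> 6 * (real (card V))\<^sup>2 * ?D"
      using that by (intro metropolis_gap V E conn) simp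
    also have "\<dots> \<le> 6 * U\<^sup>2 * ?D"
      using U D by (intro mult_right_mono mult_left_mono power_mono) auto
    finally have "2 / (9 * U)\<^sup>2 * node_inner V x x \<le> 2 / (9 * U)\<^sup>2 * (6 * U\<^sup>2 * ?D)"
      by (intro mult_left_mono) auto
    also have "\<dots> = 12 / 81 * ?D"
      using U1 by (simp add: power2_eq_square)
    also have "\<dots> \<le> ?D / 4"
      using D by simp
    finally show ?thesis
      by (simp add: right left_diff_distrib)
  qed
qed

section \<open>Formations\<close>

text \<open>
  The difference of two formations does not change along an edge, hence is constant on a connected
  graph, and its value is the difference of the centroids.
\<close>
lemma in_formation_unique:
  assumes "connected_graph {1..n} E" "E \<subseteq> {1..n} \<times> {1..n}"
    and "in_formation E r q" "in_formation E r q'" "centroid n q = centroid n q'"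
    and "i \<in> {1..n}"
  shows "q i = q' i"
proof -
  have "q j - q' j = q i - q' i" if "(i, j) \<in> E\<^sup>*" for j
    using that
  proof induction
    case (step j k)
    have "q k - q j = r j k" "q' k - q' j = r j k"
      using step.hyps(2) assms(3,4) unfolding in_formation_def by blast+
    then have same: "q k - q j = q' k - q' j"
      by (simp only:)
    have "q k - q' k = (q k - q j) - (q' k - q' j) + (q j - q' j)"
      by simp
    also have "\<dots> = q i - q' i"
      by (simp only: same step.IH diff_self add_0)
    finally show ?case .
  qed simp
  then have const: "q j - q' j = q i - q' i" if "j \<in> {1..n}" for j
    using assms(1,6) that unfolding connected_graph_def by blast
  have n: "real n \<noteq> 0"
    using assms(6) by auto
  have "0 = (\<Sum>j=1..n. q j - q' j)"
    using assms(5) n by (simp add: centroid_def sum_subtractf)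
  also have "\<dots> = (\<Sum>j=1..n. q i - q' i)"
    by (intro sum.cong refl const)
  also have "\<dots> = real n *\<^sub>R (q i - q' i)"
    by (simp add: sum_constant_scaleR del: sum_constant)
  finally show ?thesis
    using n by simp
qed

lemma ex1_formation_with_centroid:
  assumes "connected_graph {1..n} E" "E \<subseteq> {1..n} \<times> {1..n}" "valid_formation E r"
  shows "\<exists>!q. q \<in> {1..n} \<rightarrow>\<^sub>E UNIV \<and> in_formation E r q \<and> centroid n q = c"
proof (rule ex_ex1I)
  obtain q0 where q0: "in_formation E r q0"
    using assms(3) unfolding valid_formation_def by blast
  have n: "real n \<noteq> 0"
    using assms(1) unfolding connected_graph_def by (cases "n = 0") simp_all
  define q where "q = (\<lambda>i\<in>{1..n}. q0 i + (c - centroid n q0))"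
  have "q \<in> {1..n} \<rightarrow>\<^sub>E UNIV"
    by (auto simp: q_def)
  moreover have "in_formation E r q"
    unfolding in_formation_def
  proof clarify
    fix i j assume ij: "(i, j) \<in> E"
    then have "q j - q i = q0 j - q0 i"
      using assms(2) by (auto simp: q_def)
    also have "\<dots> = r i j"
      using q0 ij unfolding in_formation_def by blast
    finally show "q j - q i = r i j" .
  qed
  moreover have "centroid n q = c"
  proof -
    have "(\<Sum>i=1..n. q i) = (\<Sum>i=1..n. q0 i) + real n *\<^sub>R (c - centroid n q0)"
      by (simp add: q_def sum.distrib sum_constant_scaleR del: sum_constant)
    then show ?thesis
      using n by (simp add: centroid_def algebra_simps)
  qed
  ultimately show "\<exists>q. q \<in> {1..n} \<rightarrow>\<^sub>E UNIV \<and> in_formation E r q \<and> centroid n q = c"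
    by blast
next
  fix q q'
  assume q: "q \<in> {1..n} \<rightarrow>\<^sub>E UNIV \<and> in_formation E r q \<and> centroid n q = c"
    and q': "q' \<in> {1..n} \<rightarrow>\<^sub>E UNIV \<and> in_formation E r q' \<and> centroid n q' = c"
  have "q i = q' i" if "i \<in> {1..n}" for i
    using in_formation_unique[OF assms(1,2), of r q q' i] q q' that by simp
  then show "q = q'"
    by (rule PiE_ext[OF conjunct1[OF q] conjunct1[OF q']])
qed

theorem corollary4p2:
  fixes n :: nat
    and E :: "(nat \<times> nat) set"
    and r :: "nat \<Rightarrow> nat \<Rightarrow> real ^ 'd"
    and U :: real
    and p y :: "nat \<Rightarrow> nat \<Rightarrow> real ^ 'd"
  assumes "bidirectional_graph {1..n} E"
    and "connected_graph {1..n} E"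
    and "valid_formation E r"
    and "U \<ge> real n"
    and "\<And>i. i \<in> {1..n} \<Longrightarrow> y i 1 = p i 1"
    and "\<And>i t. i \<in> {1..n} \<Longrightarrow> t \<ge> 1 \<Longrightarrow>
           y i (t + 1) = p i t + (1 / 2) *\<^sub>R
             (\<Sum>j\<in>nbrs E i. (1 / real (max (deg E i) (deg E j))) *\<^sub>R (p j t - p i t - r i j))"
    and "\<And>i t. i \<in> {1..n} \<Longrightarrow> t \<ge> 1 \<Longrightarrow>
           p i (t + 1) = y i (t + 1) + (1 - 2 / (9 * U + 1)) *\<^sub>R (y i (t + 1) - y i t)"
  shows "(\<exists>!q. q \<in> {1..n} \<rightarrow>\<^sub>E UNIV \<and> in_formation E r q \<and>
                centroid n q = centroid n (\<lambda>i. p i 1)) \<and>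
         (\<forall>q. in_formation E r q \<and> centroid n q = centroid n (\<lambda>i. p i 1) \<longrightarrow>
            (\<forall>t\<ge>1. (\<Sum>i=1..n. (norm (y i t - q i))\<^sup>2)
               \<le> 2 * (1 - 1 / (9 * U)) ^ (t - 1) * (\<Sum>i=1..n. (norm (y i 1 - q i))\<^sup>2)))"
proof (intro conjI allI impI)
  let ?V = "{1..n}"
  have E: "E \<subseteq> ?V \<times> ?V" "sym E"
    using assms(1) by (auto simp: bidirectional_graph_def)
  have "?V \<noteq> {}"
    using assms(2) unfolding connected_graph_def by blast
  then have n: "1 \<le> n"
    by simp
  then have U1: "1 \<le> U"
    using assms(4) by simp
  show "\<exists>!q. q \<in> ?V \<rightarrow>\<^sub>E UNIV \<and> in_formation E r q \<and> centroid n q = centroid n (\<lambda>i. p i 1)"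
    by (rule ex1_formation_with_centroid[OF assms(2) E(1) assms(3)])
  fix q and t :: nat
  assume q: "in_formation E r q \<and> centroid n q = centroid n (\<lambda>i. p i 1)" and t: "1 \<le> t"
  interpret accelerated_form "node_inner ?V :: (nat \<Rightarrow> real ^ 'd) \<Rightarrow> _"
    "averaging ?V (metropolis E)" "{f. sum f ?V = 0}" "9 * U"
    using metropolis_accelerated_form[of ?V E U] E assms(2,4) by simp
  have \<sigma>: "\<sigma> = 1 - 2 / (9 * U + 1)"
    using one_minus_\<sigma> by simp
  \<comment> \<open>The errors are extended by 0 outside the node set, where the averaging operator acts as the
    identity, so that the recurrences hold as equations between functions. Time is shifted to
    start at 0.\<close>
  define z where "z k i = (if i \<in> ?V then y i (k + 1) - q i else 0)" for k i
  define x where "x k i = (if i \<in> ?V then p i (k + 1) - q i else 0)" for k i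
  have "centroid n q = centroid n (\<lambda>i. p i 1)"
    using q by blast
  then have "(\<Sum>i\<in>?V. p i 1 - q i) = 0"
    using n by (simp add: centroid_def sum_subtractf)
  then have "z 0 \<in> {f. sum f ?V = 0}"
    using assms(5) by (simp add: z_def)
  moreover have "x 0 = z 0"
    using assms(5) by (auto simp: x_def z_def)
  moreover have "z (Suc k) = averaging ?V (metropolis E) (x k)" for k
  proof
    fix i
    show "z (Suc k) i = averaging ?V (metropolis E) (x k) i"
    proof (cases "i \<in> ?V")
      case True
      have "p j (k + 1) - p i (k + 1) - r i j = x k j - x k i" if "j \<in> nbrs E i" for j
      proof -
        have ij: "(i, j) \<in> E"
          using that by (simp add: nbrs_def)
        then have "j \<in> ?V"
          using E(1) by blast
        moreover have "q j - q i = r i j"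
          using bspec[OF conjunct1[OF q, unfolded in_formation_def] ij] by simp
        ultimately show ?thesis
          using True by (simp add: x_def flip: \<open>q j - q i = r i j\<close>)
      qed
      then show ?thesis
        using assms(6)[OF True, of "k + 1"] True
        unfolding averaging_metropolis[OF finite_atLeastAtMost E(1)]
        by (simp add: z_def x_def[of k i])
    next
      case False
      then have "nbrs E i = {}"
        using E(1) unfolding nbrs_def by blast
      then show ?thesis
        unfolding averaging_metropolis[OF finite_atLeastAtMost E(1)]
        using False by (auto simp: z_def x_def)
    qed
  qed
  moreover have "x (Suc k) = z (Suc k) + \<sigma> *\<^sub>R (z (Suc k) - z k)" for k
    using assms(7)[of _ "k + 1"] by (auto simp: fun_eq_iff x_def z_def \<sigma>)
  ultimately have "node_inner ?V (z (t - 1)) (z (t - 1)) \<le> 2 * \<sigma> ^ (t - 1) * node_inner ?V (z 0) (z 0)"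
    by (rule convergence)
  moreover have z_norm: "node_inner ?V (z k) (z k) = (\<Sum>i\<in>?V. (norm (y i (k + 1) - q i))\<^sup>2)" for k
    by (simp add: node_inner_def z_def power2_norm_eq_inner)
  ultimately have "(\<Sum>i\<in>?V. (norm (y i t - q i))\<^sup>2)
      \<le> 2 * \<sigma> ^ (t - 1) * (\<Sum>i\<in>?V. (norm (y i 1 - q i))\<^sup>2)"
    using t by simp
  also have "\<dots> \<le> 2 * (1 - 1 / (9 * U)) ^ (t - 1) * (\<Sum>i\<in>?V. (norm (y i 1 - q i))\<^sup>2)"
  proof (intro mult_right_mono mult_left_mono power_mono)
    have "1 / (9 * U) = 2 / (18 * U)"
      by simp
    also have "\<dots> \<le> 2 / (9 * U + 1)"
      using U1 by (intro divide_left_mono) auto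
    finally show "\<sigma> \<le> 1 - 1 / (9 * U)"
      by (simp add: \<sigma>)
    show "0 \<le> \<sigma>"
      using \<sigma>_pos by simp
  qed (auto intro: sum_nonneg)
  finally show "(\<Sum>i=1..n. (norm (y i t - q i))\<^sup>2)
      \<le> 2 * (1 - 1 / (9 * U)) ^ (t - 1) * (\<Sum>i=1..n. (norm (y i 1 - q i))\<^sup>2)" .
qed

end
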